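(* Let $A$ be a finite set. (i) For every family of (possibly correlated) Bernoulli random variables $\{X_i\}_{i\in A}$ with support $\mathcal{R}\subseteq\{0,1\}^A$ and probability mass function $p:\mathcal{R}\to[0,1]$, there exists a coverage function $f=(U,\{w_u\}_{u\in U},A,h)$ with $|U|\le|\mathcal{R}|$ such that $f(S)=\Pr[\exists i\in S.\ X_i>0]$ for every $S\subseteq A$. (ii) Moreover, for every coverage function $f=(U,\{w_u\}_{u\in U},A,h)$ with $\mathrm{Im}(f)\subseteq[0,1]$, there exist (possibly correlated) Bernoulli random variables $\{X_i\}_{i\in A}$ with support $\mathcal{R}\subseteq\{0,1\}^A$ such that $f(S)=\Pr[\exists i\in S.\ X_i>0]$ for every $S\subseteq A$, and $|\mathcal{R}|\le|U|+1$.
   Context: A set function $f:2^A\to\mathbb{R}_{\ge0}$ is coverage if there is a (finite) set $U$ with non-negative weights $\{w_u\}_{u\in U}$ and a mapping $h:A\to2^U$ such that $f(S)=\sum_{u\in U}w_u\cdot\mathbb{1}[\exists i\in S.\ u\in h(i)]$ for every $S\subseteq A$. Such a function is described by the tuple $(U,\{w_u\}_{u\in U},A,h)$. The support of $\{X_i\}_{i\in A}$ is the set of vectors in $\{0,1\}^A$ attained with positive probability by $(X_i)_{i\in A}$. *)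

theory Defs
  imports "HOL-Probability.Probability"
begin

text \<open>The set function \<open>f\<close> on the subsets of \<open>A\<close> is the coverage function described by
  the tuple \<open>(U, w, A, h)\<close>. The values of \<open>f\<close> outside \<open>Pow A\<close>, of \<open>w\<close> outside \<open>U\<close> and of
  \<open>h\<close> outside \<open>A\<close> are irrelevant.\<close>

definition coverage_fun ::
  "'u set \<Rightarrow> ('u \<Rightarrow> real) \<Rightarrow> 'a set \<Rightarrow> ('a \<Rightarrow> 'u set) \<Rightarrow> ('a set \<Rightarrow> real) \<Rightarrow> bool" where
  "coverage_fun U w A h f \<longleftrightarrow>
     finite U \<and> (\<forall>u\<in>U. 0 \<le> w u) \<and> h \<in> A \<rightarrow> Pow U \<and>
     (\<forall>S. S \<subseteq> A \<longrightarrow> f S = (\<Sum>u\<in>U. w u * of_bool (\<exists>i\<in>S. u \<in> h i)))"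

text \<open>Being Bernoulli is a property of the law, so \<open>X\<close> takes values in \<open>{0, 1}\<close> almost surely.\<close>

definition bernoulli_rv :: "'w measure \<Rightarrow> ('w \<Rightarrow> real) \<Rightarrow> bool" where
  "bernoulli_rv M X \<longleftrightarrow>
     X \<in> borel_measurable M \<and>
     (\<exists>q\<in>{0..1}. distr M borel X = distr (measure_pmf (bernoulli_pmf q)) borel of_bool)"

definition joint_pmf :: "'w measure \<Rightarrow> 'a set \<Rightarrow> ('a \<Rightarrow> 'w \<Rightarrow> real) \<Rightarrow> ('a \<Rightarrow> real) \<Rightarrow> real" where
  "joint_pmf M A X x = \<P>(\<omega> in M. \<forall>i\<in>A. X i \<omega> = x i)"

text \<open>Vectors in \<open>{0, 1}\<^sup>A\<close> are extensional functions, so that distinct functions are distinct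
  vectors and the cardinality of the support is the intended one.\<close>

definition joint_support :: "'w measure \<Rightarrow> 'a set \<Rightarrow> ('a \<Rightarrow> 'w \<Rightarrow> real) \<Rightarrow> ('a \<Rightarrow> real) set" where
  "joint_support M A X = {x \<in> A \<rightarrow>\<^sub>E {0, 1}. joint_pmf M A X x > 0}"

end

theory Submission imports Defs begin

text \<open>
  For (i), take the vectors of the support as the elements to be covered, weighted by their
  probability, where \<open>i\<close> covers the vectors whose \<open>i\<close>-th entry is 1. For (ii), draw a single
  element \<open>u \<in> U\<close> with probability \<open>w u\<close> and let \<open>X i\<close> indicate that \<open>i\<close> covers it. The elements
  covered by no \<open>i \<in> A\<close> may have arbitrarily large weight and so are given probability 0; the others
  have total weight \<open>f A \<le> 1\<close>, and one further element, covered by nothing, takes the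
  remaining mass.
\<close>

text \<open>An almost sure statement about the value of \<open>X\<close> depends only on its law, so
  it can be checked on the Bernoulli law, which lives on 0 and 1.\<close>

lemma bernoulli_rv_AE:
  assumes "bernoulli_rv M X"
  shows "AE \<omega> in M. X \<omega> \<in> {0, 1}"
proof -
  obtain q where X: "X \<in> borel_measurable M"
    and q: "distr M borel X = distr (measure_pmf (bernoulli_pmf q)) borel of_bool"
    using assms by (auto simp: bernoulli_rv_def)
  have "AE x in distr (measure_pmf (bernoulli_pmf q)) borel of_bool. x \<in> {0, 1 :: real}"
    by (subst AE_distr_iff) auto
  then have "AE x in distr M borel X. x \<in> {0, 1}"
    by (simp only: q)
  then show ?thesis
    using X by (subst (asm) AE_distr_iff) auto
qed

lemma bool_pmf_eq_bernoulli_pmf: "P = bernoulli_pmf (pmf P True)"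
proof (rule pmf_eqI)
  fix b
  have "pmf P True + pmf P False = 1"
    using sum_pmf_eq_1[of "UNIV :: bool set" P] by (auto simp: UNIV_bool add.commute)
  then show "pmf P b = pmf (bernoulli_pmf (pmf P True)) b"
    by (cases b) (auto simp: pmf_le_1)
qed

text \<open>The indicator factors through the booleans, and every distribution on the booleans is
  Bernoulli, with the mass of \<open>True\<close> as its parameter.\<close>

lemma bernoulli_rv_of_bool:
  "bernoulli_rv (measure_pmf P) (\<lambda>x. of_bool (B x))"
proof -
  define q where "q = pmf (map_pmf B P) True"
  have B: "map_pmf B P = bernoulli_pmf q"
    unfolding q_def by (rule bool_pmf_eq_bernoulli_pmf)
  have "distr (measure_pmf P) borel (\<lambda>x. of_bool (B x) :: real)
      = distr (distr (measure_pmf P) (count_space UNIV) B) borel of_bool"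
    by (subst distr_distr) (auto simp: comp_def)
  also have "\<dots> = distr (measure_pmf (bernoulli_pmf q)) borel of_bool"
    by (simp add: map_pmf_rep_eq flip: B)
  finally show ?thesis
    by (auto simp: bernoulli_rv_def q_def pmf_le_1 intro!: bexI[of _ q])
qed

lemma finite_joint_support:
  assumes "finite A"
  shows "finite (joint_support M A X)"
  by (rule finite_subset[of _ "A \<rightarrow>\<^sub>E {0, 1}"])
    (use assms in \<open>auto simp: joint_support_def intro: finite_PiE\<close>)

text \<open>Up to a null set, the event is the disjoint union of the events "the joint vector equals
  \<open>x\<close>", over the 0-1 vectors \<open>x\<close> with a 1 somewhere in
  \<open>S\<close>.\<close>

lemma prob_ex_pos_eq_sum_joint_support:
  fixes X :: "'a \<Rightarrow> 'w \<Rightarrow> real"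
  assumes "finite A" "prob_space M" and X: "\<forall>i\<in>A. bernoulli_rv M (X i)"
    and "S \<subseteq> A"
  shows "\<P>(\<omega> in M. \<exists>i\<in>S. X i \<omega> > 0)
    = (\<Sum>x\<in>joint_support M A X. joint_pmf M A X x * of_bool (\<exists>i\<in>S. x i = 1))"
proof -
  interpret prob_space M by fact
  have [measurable]: "X i \<in> borel_measurable M" if "i \<in> A" for i
    using X that by (simp add: bernoulli_rv_def)
  have [measurable]: "X i \<in> borel_measurable M" if "i \<in> S" for i
    using that \<open>S \<subseteq> A\<close> by auto
  have "finite S"
    using assms by (auto intro: finite_subset)
  define E where "E x = {\<omega> \<in> space M. \<forall>i\<in>A. X i \<omega> = x i}" for x
  have E_sets: "E x \<in> sets M" for x
    unfolding E_def using \<open>finite A\<close> by measurable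
  \<comment> \<open>\<open>Q\<close> also keeps vectors of probability 0, so that the decomposition
    holds at every outcome where all \<open>X i\<close> are 0 or 1.\<close>
  define Q where "Q = {x \<in> A \<rightarrow>\<^sub>E {0, 1 :: real}. \<exists>i\<in>S. x i = 1}"
  have "finite Q"
    by (rule finite_subset[of _ "A \<rightarrow>\<^sub>E {0, 1}"])
      (use \<open>finite A\<close> in \<open>auto simp: Q_def intro: finite_PiE\<close>)
  have "AE \<omega> in M. \<forall>i\<in>A. X i \<omega> \<in> {0, 1}"
    using bernoulli_rv_AE X \<open>finite A\<close> by (subst AE_finite_all) auto
  then have "AE \<omega> in M. \<omega> \<in> {\<omega> \<in> space M. \<exists>i\<in>S. X i \<omega> > 0} \<longleftrightarrow> \<omega> \<in> (\<Union>x\<in>Q. E x)"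
    using AE_space
  proof eventually_elim
    case (elim \<omega>)
    \<comment> \<open>Restricting to \<open>A\<close> makes the observed vector extensional, as
      membership in \<open>Q\<close> demands.\<close>
    have "restrict (\<lambda>i. X i \<omega>) A \<in> Q \<and> \<omega> \<in> E (restrict (\<lambda>i. X i \<omega>) A)"
      if "i \<in> S" "X i \<omega> > 0" for i
      using that elim \<open>S \<subseteq> A\<close> by (force simp: Q_def E_def)
    moreover have "\<exists>i\<in>S. X i \<omega> > 0" if "x \<in> Q" "\<omega> \<in> E x" for x
      using that \<open>S \<subseteq> A\<close> by (force simp: Q_def E_def)
    ultimately show ?case
      using elim by blast
  qed
  then have "\<P>(\<omega> in M. \<exists>i\<in>S. X i \<omega> > 0) = prob (\<Union>x\<in>Q. E x)"
  proof (rule finite_measure_eq_AE)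
    show "{\<omega> \<in> space M. \<exists>i\<in>S. X i \<omega> > 0} \<in> sets M"
      using \<open>finite S\<close> by measurable
    show "(\<Union>x\<in>Q. E x) \<in> sets M"
      using \<open>finite Q\<close> E_sets by (intro sets.finite_UN)
  qed
  also have "\<dots> = (\<Sum>x\<in>Q. prob (E x))"
  proof (rule finite_measure_finite_Union)
    show "disjoint_family_on E Q"
      unfolding disjoint_family_on_def
    proof (intro ballI impI)
      fix x y assume "x \<in> Q" "y \<in> Q" "x \<noteq> y"
      then have "x \<in> A \<rightarrow>\<^sub>E {0, 1}" "y \<in> A \<rightarrow>\<^sub>E {0, 1}"
        by (simp_all add: Q_def)
      \<comment> \<open>Extensional functions that differ must differ inside \<open>A\<close>, and
        there \<open>X i\<close> cannot take both values.\<close>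
      then obtain i where "i \<in> A" "x i \<noteq> y i"
        using \<open>x \<noteq> y\<close> PiE_ext by metis
      then show "E x \<inter> E y = {}"
        by (force simp: E_def)
    qed
  qed (use \<open>finite Q\<close> E_sets in auto)
  \<comment> \<open>Neither index set need contain the other: vectors only in \<open>Q\<close> have
    probability 0, and vectors only in the support have no 1 in \<open>S\<close>, so their indicator
    vanishes.\<close>
  also have "\<dots> = (\<Sum>x\<in>joint_support M A X. joint_pmf M A X x * of_bool (\<exists>i\<in>S. x i = 1))"
  proof (rule sum.mono_neutral_cong)
    fix x assume "x \<in> Q - joint_support M A X"
    then have "\<not> prob (E x) > 0"
      by (auto simp: Q_def joint_support_def joint_pmf_def E_def)
    then show "prob (E x) = 0"
      by (simp add: zero_less_measure_iff)
  qed (use \<open>finite Q\<close> finite_joint_support[OF \<open>finite A\<close>] in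
      \<open>auto simp: Q_def joint_support_def joint_pmf_def E_def\<close>)
  finally show ?thesis .
qed

text \<open>The sum over the support already has the shape of a coverage function. Enumerating the
  support by \<open>g\<close> moves its universe to the naturals without changing the size.\<close>

lemma coverage_fun_of_bernoulli:
  fixes X :: "'a \<Rightarrow> 'w \<Rightarrow> real"
  assumes "finite A" "prob_space M" "\<forall>i\<in>A. bernoulli_rv M (X i)"
  shows "\<exists>(U :: nat set) w h.
    coverage_fun U w A h (\<lambda>S. \<P>(\<omega> in M. \<exists>i\<in>S. X i \<omega> > 0)) \<and>
    card U = card (joint_support M A X)"
proof -
  define R where "R = joint_support M A X"
  have "finite R"
    unfolding R_def using \<open>finite A\<close> by (rule finite_joint_support)
  then obtain g where g: "bij_betw g {..<card R} R"
    using ex_bij_betw_nat_finite by (auto simp: atLeast0LessThan)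
  define w where "w k = joint_pmf M A X (g k)" for k
  define h where "h i = {k \<in> {..<card R}. g k i = 1}" for i
  have "\<P>(\<omega> in M. \<exists>i\<in>S. X i \<omega> > 0) = (\<Sum>k<card R. w k * of_bool (\<exists>i\<in>S. k \<in> h i))"
    if "S \<subseteq> A" for S
  proof -
    have "\<P>(\<omega> in M. \<exists>i\<in>S. X i \<omega> > 0) = (\<Sum>x\<in>R. joint_pmf M A X x * of_bool (\<exists>i\<in>S. x i = 1))"
      unfolding R_def by (rule prob_ex_pos_eq_sum_joint_support[OF assms that])
    also have "\<dots> = (\<Sum>k<card R. joint_pmf M A X (g k) * of_bool (\<exists>i\<in>S. g k i = 1))"
      by (rule sum.reindex_bij_betw[OF g, symmetric])
    also have "\<dots> = (\<Sum>k<card R. w k * of_bool (\<exists>i\<in>S. k \<in> h i))"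
      by (auto simp: w_def h_def intro!: sum.cong)
    finally show ?thesis .
  qed
  then have "coverage_fun {..<card R} w A h (\<lambda>S. \<P>(\<omega> in M. \<exists>i\<in>S. X i \<omega> > 0))"
    by (auto simp: coverage_fun_def w_def h_def joint_pmf_def)
  then show ?thesis
    by (intro exI conjI) (assumption, simp add: R_def)
qed

text \<open>The outcomes are indices: \<open>k < n\<close> stands for the element \<open>g k\<close>
  of \<open>U\<close>, and \<open>n\<close> for the additional uncovered element, whose mass
  \<open>1 - f A\<close> is nonnegative because \<open>f A \<le> 1\<close>.\<close>

lemma bernoulli_of_coverage_fun:
  fixes f :: "'a set \<Rightarrow> real" and U :: "'u set"
  assumes cov: "coverage_fun U w A h f" and "f A \<le> 1"
  shows "\<exists>(P :: nat pmf) (X :: 'a \<Rightarrow> nat \<Rightarrow> real).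
    (\<forall>i\<in>A. bernoulli_rv P (X i)) \<and>
    (\<forall>S. S \<subseteq> A \<longrightarrow> f S = \<P>(\<omega> in P. \<exists>i\<in>S. X i \<omega> > 0)) \<and>
    card (joint_support P A X) \<le> card U + 1"
proof -
  have "finite U" and w: "\<And>u. u \<in> U \<Longrightarrow> 0 \<le> w u"
    and f: "\<And>S. S \<subseteq> A \<Longrightarrow> f S = (\<Sum>u\<in>U. w u * of_bool (\<exists>i\<in>S. u \<in> h i))"
    using cov by (auto simp: coverage_fun_def)
  define n where "n = card U"
  obtain g where g: "bij_betw g {..<n} U"
    using ex_bij_betw_nat_finite[OF \<open>finite U\<close>] by (auto simp: n_def atLeast0LessThan)
  have gU: "g k \<in> U" if "k < n" for k
    using g that by (auto simp: bij_betw_def)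
  have f': "f S = (\<Sum>k<n. w (g k) * of_bool (\<exists>i\<in>S. g k \<in> h i))" if "S \<subseteq> A" for S
    unfolding f[OF that] by (rule sum.reindex_bij_betw[OF g, symmetric])
  define p where "p k = (if k < n then w (g k) * of_bool (\<exists>i\<in>A. g k \<in> h i)
    else if k = n then 1 - f A else 0)" for k
  have p_nonneg: "p k \<ge> 0" for k
    using w gU \<open>f A \<le> 1\<close> by (auto simp: p_def)
  \<comment> \<open>By \<open>f'\<close> at \<open>S = A\<close>, the masses below \<open>n\<close>
    add up to \<open>f A\<close>.\<close>
  have p_sum: "(\<Sum>k\<le>n. p k) = 1"
    by (simp add: f' p_def flip: lessThan_Suc_atMost)
  have "(\<integral>\<^sup>+k. ennreal (p k) \<partial>count_space UNIV) = (\<Sum>k\<le>n. ennreal (p k))"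
    by (rule nn_integral_count_space') (auto simp: p_def)
  then have p_int: "(\<integral>\<^sup>+k. ennreal (p k) \<partial>count_space UNIV) = 1"
    by (simp add: sum_ennreal p_nonneg p_sum)
  define P where "P = embed_pmf p"
  have pmf_P: "pmf P k = p k" for k
    unfolding P_def by (rule pmf_embed_pmf[OF p_nonneg p_int])
  have set_P: "set_pmf P \<subseteq> {..n}"
    by (auto simp: set_pmf_iff pmf_P p_def split: if_splits)
  \<comment> \<open>The guard \<open>k < n\<close> is needed because \<open>g\<close> is
    unconstrained from \<open>n\<close> on, where \<open>g k\<close> might happen to lie in
    \<open>h i\<close>.\<close>
  define X :: "'a \<Rightarrow> nat \<Rightarrow> real" where "X i k = of_bool (k < n \<and> g k \<in> h i)" for i k
  have bern: "bernoulli_rv P (X i)" for i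
    unfolding X_def by (rule bernoulli_rv_of_bool)
  have prob: "f S = \<P>(\<omega> in P. \<exists>i\<in>S. X i \<omega> > 0)" if "S \<subseteq> A" for S
  proof -
    have "\<P>(\<omega> in P. \<exists>i\<in>S. X i \<omega> > 0) = measure P {k \<in> {..<n}. \<exists>i\<in>S. g k \<in> h i}"
      by (rule arg_cong[where f = "measure P"]) (auto simp: X_def)
    also have "\<dots> = (\<Sum>k | k \<in> {..<n} \<and> (\<exists>i\<in>S. g k \<in> h i). p k)"
      by (subst measure_measure_pmf_finite) (auto simp: pmf_P)
    \<comment> \<open>An index covered from \<open>S\<close> is covered from \<open>A\<close>, so
      its mass is the full weight \<open>w (g k)\<close>; the indices added on the right contribute
      0.\<close>
    also have "\<dots> = (\<Sum>k<n. w (g k) * of_bool (\<exists>i\<in>S. g k \<in> h i))"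
      by (rule sum.mono_neutral_cong_left) (use that in \<open>auto simp: p_def\<close>)
    also have "\<dots> = f S"
      using f'[OF that] by simp
    finally show ?thesis ..
  qed
  \<comment> \<open>The outcome determines the whole vector, and only the \<open>n + 1\<close>
    outcomes up to \<open>n\<close> can have positive mass.\<close>
  have "joint_support P A X \<subseteq> (\<lambda>k. restrict (\<lambda>i. X i k) A) ` {..n}"
  proof
    fix x assume x: "x \<in> joint_support P A X"
    then have "measure P {k. \<forall>i\<in>A. X i k = x i} \<noteq> 0"
      by (simp add: joint_support_def joint_pmf_def)
    then obtain k where k: "k \<in> set_pmf P" "\<forall>i\<in>A. X i k = x i"
      by (auto simp: measure_pmf_zero_iff)
    have "x \<in> extensional A"
      using x by (auto simp: joint_support_def PiE_def)
    then have "x = restrict (\<lambda>i. X i k) A"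
      by (rule extensionalityI) (use k in auto)
    then show "x \<in> (\<lambda>k. restrict (\<lambda>i. X i k) A) ` {..n}"
      using k set_P by blast
  qed
  then have "card (joint_support P A X) \<le> card {..n}"
    by (rule surj_card_le[rotated]) simp
  then have "card (joint_support P A X) \<le> card U + 1"
    by (simp add: n_def)
  with bern prob show ?thesis
    by blast
qed

theorem proposition4p2:
  fixes A :: "'a set"
  assumes "finite A"
  shows
    "(\<forall>(M :: 'w measure) (X :: 'a \<Rightarrow> 'w \<Rightarrow> real).
        prob_space M \<and> (\<forall>i\<in>A. bernoulli_rv M (X i)) \<longrightarrow>
        (\<exists>(f :: 'a set \<Rightarrow> real) (U :: nat set) w h.
           coverage_fun U w A h f \<and>
           card U \<le> card (joint_support M A X) \<and>
           (\<forall>S. S \<subseteq> A \<longrightarrow> f S = \<P>(\<omega> in M. \<exists>i\<in>S. X i \<omega> > 0))))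
     \<and>
     (\<forall>(f :: 'a set \<Rightarrow> real) (U :: 'u set) w h.
        coverage_fun U w A h f \<and> f ` Pow A \<subseteq> {0..1} \<longrightarrow>
        (\<exists>(M :: nat measure) (X :: 'a \<Rightarrow> nat \<Rightarrow> real).
           prob_space M \<and> (\<forall>i\<in>A. bernoulli_rv M (X i)) \<and>
           (\<forall>S. S \<subseteq> A \<longrightarrow> f S = \<P>(\<omega> in M. \<exists>i\<in>S. X i \<omega> > 0)) \<and>
           card (joint_support M A X) \<le> card U + 1))"
proof (intro conjI allI impI)
  fix M :: "'w measure" and X :: "'a \<Rightarrow> 'w \<Rightarrow> real"
  assume "prob_space M \<and> (\<forall>i\<in>A. bernoulli_rv M (X i))"
  then have "prob_space M" "\<forall>i\<in>A. bernoulli_rv M (X i)"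
    by simp_all
  from coverage_fun_of_bernoulli[OF assms this]
  obtain U :: "nat set" and w h where U:
    "coverage_fun U w A h (\<lambda>S. \<P>(\<omega> in M. \<exists>i\<in>S. X i \<omega> > 0)) \<and>
     card U = card (joint_support M A X)"
    by (elim exE)
  show "\<exists>(f :: 'a set \<Rightarrow> real) (U :: nat set) w h.
      coverage_fun U w A h f \<and> card U \<le> card (joint_support M A X) \<and>
      (\<forall>S. S \<subseteq> A \<longrightarrow> f S = \<P>(\<omega> in M. \<exists>i\<in>S. X i \<omega> > 0))"
    \<comment> \<open>Unification with \<open>U\<close> fixes the witness for \<open>f\<close> as
      the probability itself, which makes the last conjunct reflexive.\<close>
    by (rule exI, rule exI[of _ U], rule exI[of _ w], rule exI[of _ h],
        rule conjI, rule conjunct1[OF U]) (simp add: U)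
next
  fix f :: "'a set \<Rightarrow> real" and U :: "'u set" and w h
  assume "coverage_fun U w A h f \<and> f ` Pow A \<subseteq> {0..1}"
  then have "coverage_fun U w A h f" "f A \<le> 1"
    by (simp_all add: image_subset_iff)
  from bernoulli_of_coverage_fun[OF this]
  obtain P :: "nat pmf" and X where PX:
    "(\<forall>i\<in>A. bernoulli_rv P (X i)) \<and>
     (\<forall>S. S \<subseteq> A \<longrightarrow> f S = \<P>(\<omega> in P. \<exists>i\<in>S. X i \<omega> > 0)) \<and>
     card (joint_support P A X) \<le> card U + 1"
    by (elim exE)
  show "\<exists>(M :: nat measure) (X :: 'a \<Rightarrow> nat \<Rightarrow> real).
      prob_space M \<and> (\<forall>i\<in>A. bernoulli_rv M (X i)) \<and>
      (\<forall>S. S \<subseteq> A \<longrightarrow> f S = \<P>(\<omega> in M. \<exists>i\<in>S. X i \<omega> > 0)) \<and>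
      card (joint_support M A X) \<le> card U + 1"
    by (rule exI[of _ "measure_pmf P"], rule exI[of _ X],
        rule conjI[OF measure_pmf.prob_space_axioms PX])
qed

end
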